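(* Let $r\ge 2$ be a fixed integer and let $\Pi_n$ be a permutation chosen uniformly at random from all $n!$ permutations of $[n]=\{1,\dots,n\}$. Then, asymptotically almost surely as $n\to\infty$, $$bt^{(r)}(\Pi_n)=\left(\frac{r}{r-1}+o(1)\right)\frac{\log n}{\log\log n}.$$
   Context: A permutation is any finite sequence of distinct integers. Two permutations $(x_1,\dots,x_k)$ and $(y_1,\dots,y_k)$ of the same length are similar if $x_i<x_j$ if and only if $y_i<y_j$ for all $1\le i<j\le k$. A block in a permutation $\pi$ is a subsequence of $\pi$ occupying a non-empty segment of consecutive positions. A collection of $r$ pairwise disjoint (occupying pairwise disjoint sets of positions), pairwise similar blocks in $\pi$, each of length $k$, forms block $r$-twins of length $k$ in $\pi$. Let $bt^{(r)}(\pi)$ be the largest $k$ such that $\pi$ contains block $r$-twins of length $k$. An event $\mathcal{E}_n$ in the uniform probability space of all $n!$ permutations of $[n]$ holds asymptotically almost surely (a.a.s.) if $\mathbb{P}(\mathcal{E}_n)\to1$ as $n\to\infty$. A statement "a.a.s. $X_n=(c+o(1))a_n$" means that for every $\varepsilon>0$, $\mathbb{P}\big((c-\varepsilon)a_n\le X_n\le (c+\varepsilon)a_n\big)\to1$ as $n\to\infty$. *)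

theory Defs
  imports "HOL-Probability.Probability" "HOL-Combinatorics.Multiset_Permutations"
begin

text \<open>Permutations are finite sequences of distinct integers, represented as lists
  \<open>\<pi> :: int list\<close> with \<open>distinct \<pi>\<close>. Positions are counted from 0.\<close>

definition similar :: "int list \<Rightarrow> int list \<Rightarrow> bool" where
  "similar xs ys \<longleftrightarrow> length xs = length ys \<and>
     (\<forall>i j. i < j \<and> j < length xs \<longrightarrow> (xs ! i < xs ! j \<longleftrightarrow> ys ! i < ys ! j))"

definition block_positions :: "nat \<Rightarrow> nat \<Rightarrow> nat set" where
  "block_positions k s = {s..<s + k}"

definition block :: "int list \<Rightarrow> nat \<Rightarrow> nat \<Rightarrow> int list" where
  "block \<pi> k s = take k (drop s \<pi>)"

text \<open>A collection of blocks of common length \<open>k\<close> is given by the set \<open>S\<close> of their starting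
  positions.\<close>

definition block_twins :: "nat \<Rightarrow> nat \<Rightarrow> int list \<Rightarrow> nat set \<Rightarrow> bool" where
  "block_twins r k \<pi> S \<longleftrightarrow>
     k \<ge> 1 \<and> finite S \<and> card S = r \<and>
     (\<forall>s\<in>S. block_positions k s \<subseteq> {..<length \<pi>}) \<and>
     (\<forall>s\<in>S. \<forall>t\<in>S. s \<noteq> t \<longrightarrow> block_positions k s \<inter> block_positions k t = {}) \<and>
     (\<forall>s\<in>S. \<forall>t\<in>S. similar (block \<pi> k s) (block \<pi> k t))"

text \<open>For \<open>r \<ge> 1\<close> the set below is finite, since \<open>k \<le> length \<pi>\<close>. The inserted 0 only matters
  when there are no block twins at all, that is, when \<open>length \<pi> < r\<close>.\<close>

definition bt :: "nat \<Rightarrow> int list \<Rightarrow> nat" where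
  "bt r \<pi> = Max (insert 0 {k. \<exists>S. block_twins r k \<pi> S})"

definition random_permutation :: "nat \<Rightarrow> int list pmf" where
  "random_permutation n = pmf_of_set (permutations_of_set {1..int n})"

definition aas :: "(nat \<Rightarrow> int list \<Rightarrow> bool) \<Rightarrow> bool" where
  "aas E \<longleftrightarrow> (\<lambda>n. measure_pmf.prob (random_permutation n) {\<pi>. E n \<pi>}) \<longlonglongrightarrow> 1"

text \<open>A.a.s. \<open>X\<^sub>n = (c + o(1)) a\<^sub>n\<close>.\<close>

definition aas_asymp :: "(int list \<Rightarrow> real) \<Rightarrow> real \<Rightarrow> (nat \<Rightarrow> real) \<Rightarrow> bool" where
  "aas_asymp X c a \<longleftrightarrow>
     (\<forall>\<epsilon>>0. aas (\<lambda>n \<pi>. (c - \<epsilon>) * a n \<le> X \<pi> \<and> X \<pi> \<le> (c + \<epsilon>) * a n))"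

end

theory Submission
  imports Defs "HOL-Real_Asymp.Real_Asymp"
begin

text \<open>Two blocks form twins when they have the same pattern, that is, the same order-isomorphism
  type. In a uniformly random permutation the patterns of disjoint blocks of length \<open>k\<close> are
  independent and uniform over all \<open>k!\<close> patterns (\<open>card_prescribed_patterns\<close>), so block
  \<open>r\<close>-twins of length \<open>k\<close> amount to an \<open>r\<close>-fold coincidence among uniform samples.
  The critical quantity is \<open>n\<^sup>r / (k!)\<^sup>r\<^sup>-\<^sup>1\<close>: for \<open>k = y ln n / ln ln n\<close> we have
  \<open>k! = n\<^sup>y\<^sup>+\<^sup>o\<^sup>(\<^sup>1\<^sup>)\<close>, and \<open>r - (r - 1) y\<close> changes sign at \<open>y = r / (r - 1)\<close>.

  Above the threshold a union bound over the starting positions of the blocks suffices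
  (\<open>prob_le_bt\<close>).

  Below the threshold, cut the permutation into \<open>m = n div k\<close> consecutive blocks. Their patterns
  are \<open>m\<close> balls thrown into \<open>N = k!\<close> bins, and twins are missing only if no bin receives
  \<open>r\<close> balls. Instead of a second moment computation, the ball configurations of this kind are
  counted through their exponential generating function \<open>P(x)\<^sup>N\<close>, where \<open>P\<close> is the truncated
  exponential series \<open>\<Sum>i<r. x\<^sup>i / i!\<close> (\<open>card_sparse_maps_le\<close>). Bounding the coefficient of
  \<open>x\<^sup>m\<close> by \<open>P(x)\<^sup>N / x\<^sup>m\<close> at \<open>x = m / N\<close> compares the balls with independent Poisson variables
  of mean \<open>m / N\<close>. The comparison costs only a factor of order \<open>m\<close> from Stirling's formula,
  while the resulting bound contains \<open>exp (- c m\<^sup>r / N\<^sup>r\<^sup>-\<^sup>1)\<close>, which decays faster than any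
  power of \<open>n\<close> (\<open>prob_bt_less\<close>).\<close>

section \<open>Patterns\<close>

text \<open>The order-isomorphism type of a list of distinct integers: every entry is replaced by its
  rank, counted from 0. Similar lists are those with equal patterns, so that similarity of blocks
  becomes a coincidence of random variables with \<open>k!\<close> possible values.\<close>

definition pattern :: "int list \<Rightarrow> nat list" where
  "pattern xs = map (\<lambda>x. card {y \<in> set xs. y < x}) xs"

abbreviation patterns :: "nat \<Rightarrow> nat list set" where
  "patterns k \<equiv> permutations_of_set {..<k}"

lemma length_pattern [simp]: "length (pattern xs) = length xs"
  by (simp add: pattern_def)

lemma card_smaller_less_iff:
  assumes "finite A" "x \<in> A" "x' \<in> A"
  shows "card {y \<in> A. y < x} < card {y \<in> A. y < x'} \<longleftrightarrow> x < (x' :: int)"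
proof
  assume "x < x'"
  with assms show "card {y \<in> A. y < x} < card {y \<in> A. y < x'}"
    by (intro psubset_card_mono) auto
next
  assume *: "card {y \<in> A. y < x} < card {y \<in> A. y < x'}"
  show "x < x'"
  proof (rule ccontr)
    assume "\<not> x < x'"
    then have "card {y \<in> A. y < x'} \<le> card {y \<in> A. y < x}"
      using assms by (intro card_mono) auto
    with * show False by simp
  qed
qed

lemma pattern_nth_less_iff:
  assumes "i < length xs" "j < length xs"
  shows "pattern xs ! i < pattern xs ! j \<longleftrightarrow> xs ! i < xs ! j"
  using assms by (simp add: pattern_def card_smaller_less_iff)

lemma pattern_in_patterns:
  assumes "distinct xs"
  shows "pattern xs \<in> patterns (length xs)"
proof
  let ?f = "\<lambda>x. card {y \<in> set xs. y < x}"
  have inj: "inj_on ?f (set xs)"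
  proof (rule inj_onI)
    fix x y assume "x \<in> set xs" "y \<in> set xs" "?f x = ?f y"
    then show "x = y"
      using card_smaller_less_iff[of "set xs" x y] card_smaller_less_iff[of "set xs" y x] by auto
  qed
  then show "distinct (pattern xs)"
    using assms by (simp add: pattern_def distinct_map)
  have "?f x < length xs" if "x \<in> set xs" for x
  proof -
    have "?f x < card (set xs)"
      using that by (intro psubset_card_mono) auto
    then show ?thesis using assms by (simp add: distinct_card)
  qed
  then have "?f ` set xs \<subseteq> {..<length xs}" by auto
  moreover have "card (?f ` set xs) = card {..<length xs}"
    using inj assms by (simp add: card_image distinct_card)
  ultimately show "set (pattern xs) = {..<length xs}"
    by (simp add: pattern_def card_subset_eq)
qed

lemma similar_iff_pattern_eq:
  assumes "distinct xs" "distinct ys"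
  shows "similar xs ys \<longleftrightarrow> pattern xs = pattern ys"
proof
  assume sim: "similar xs ys"
  then have len: "length xs = length ys" by (simp add: similar_def)
  have *: "xs ! i < xs ! j \<longleftrightarrow> ys ! i < ys ! j" if "i < length xs" "j < length xs" for i j
  proof -
    consider "i < j" | "i = j" | "j < i" by linarith
    then show ?thesis
    proof cases
      case 1
      then show ?thesis using sim that by (auto simp: similar_def)
    next
      case 3
      then have "xs ! j < xs ! i \<longleftrightarrow> ys ! j < ys ! i"
        using sim that by (auto simp: similar_def)
      moreover have "xs ! i \<noteq> xs ! j" "ys ! i \<noteq> ys ! j"
        using that 3 assms len by (auto simp: nth_eq_iff_index_eq)
      ultimately show ?thesis by linarith
    qed auto
  qed
  have rank: "card {y \<in> set zs. y < z} = card {j. j < length zs \<and> zs ! j < z}"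
    if "distinct zs" for zs :: "int list" and z
  proof -
    have "{y \<in> set zs. y < z} = (!) zs ` {j. j < length zs \<and> zs ! j < z}"
      by (auto simp: in_set_conv_nth)
    moreover have "inj_on ((!) zs) {j. j < length zs \<and> zs ! j < z}"
      using that by (auto simp: inj_on_def nth_eq_iff_index_eq)
    ultimately show ?thesis by (simp add: card_image)
  qed
  show "pattern xs = pattern ys"
  proof (rule nth_equalityI)
    fix i assume "i < length (pattern xs)"
    then have i: "i < length xs" by simp
    then have "{j. j < length xs \<and> xs ! j < xs ! i} = {j. j < length ys \<and> ys ! j < ys ! i}"
      using * len by auto
    then show "pattern xs ! i = pattern ys ! i"
      using i len by (simp add: pattern_def rank[OF assms(1)] rank[OF assms(2)])
  qed (use len in simp)
next
  assume eq: "pattern xs = pattern ys"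
  then have len: "length xs = length ys" by (metis length_pattern)
  show "similar xs ys"
    unfolding similar_def
    using len pattern_nth_less_iff[of _ xs] pattern_nth_less_iff[of _ ys] eq by auto
qed

lemma pattern_permute_list:
  assumes "f permutes {..<length xs}"
  shows "pattern (permute_list f xs) = permute_list f (pattern xs)"
  using assms by (simp add: pattern_def permute_list_map)

section \<open>Patterns of disjoint blocks are independent and uniform\<close>

definition separated :: "nat \<Rightarrow> nat \<Rightarrow> nat set \<Rightarrow> bool" where
  "separated k n S \<longleftrightarrow> (\<forall>s\<in>S. s + k \<le> n) \<and>
     (\<forall>s\<in>S. \<forall>t\<in>S. s \<noteq> t \<longrightarrow> s + k \<le> t \<or> t + k \<le> s)"

abbreviation perms :: "nat \<Rightarrow> int list set" where
  "perms n \<equiv> permutations_of_set {1..int n}"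

lemma length_perms: "\<pi> \<in> perms n \<Longrightarrow> length \<pi> = n"
  by (simp add: length_finite_permutations_of_set)

lemma length_block: "s + k \<le> length \<pi> \<Longrightarrow> length (block \<pi> k s) = k"
  by (simp add: block_def)

lemma distinct_block: "distinct \<pi> \<Longrightarrow> distinct (block \<pi> k s)"
  by (simp add: block_def)

lemma pattern_block_in_patterns:
  assumes "\<pi> \<in> perms n" "s + k \<le> n"
  shows "pattern (block \<pi> k s) \<in> patterns k"
  using pattern_in_patterns[OF distinct_block[of \<pi> k s]] assms
  by (simp add: permutations_of_setD length_block length_perms)

definition shuffle_block :: "(nat \<Rightarrow> nat) \<Rightarrow> nat \<Rightarrow> nat \<Rightarrow> int list \<Rightarrow> int list" where
  "shuffle_block f k s \<pi> = take s \<pi> @ permute_list f (block \<pi> k s) @ drop (s + k) \<pi>"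

lemma append_block: "take s \<pi> @ block \<pi> k s @ drop (s + k) \<pi> = \<pi>"
  unfolding block_def by (metis add.commute append_take_drop_id drop_drop)

lemma block_shuffle_block_same:
  assumes "s + k \<le> length \<pi>"
  shows "block (shuffle_block f k s \<pi>) k s = permute_list f (block \<pi> k s)"
  using assms by (simp add: shuffle_block_def block_def)

lemma length_shuffle_block [simp]:
  "s + k \<le> length \<pi> \<Longrightarrow> length (shuffle_block f k s \<pi>) = length \<pi>"
  by (simp add: shuffle_block_def block_def)

lemma block_shuffle_block_other:
  assumes "s + k \<le> length \<pi>" "t + k \<le> length \<pi>" "s + k \<le> t \<or> t + k \<le> s"
  shows "block (shuffle_block f k s \<pi>) k t = block \<pi> k t"
proof (rule nth_equalityI)
  show "length (block (shuffle_block f k s \<pi>) k t) = length (block \<pi> k t)"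
    using assms by (simp add: length_block)
  fix i assume "i < length (block (shuffle_block f k s \<pi>) k t)"
  then have i: "i < k" using assms by (simp add: length_block)
  then have "shuffle_block f k s \<pi> ! (t + i) = \<pi> ! (t + i)"
    using assms by (auto simp: shuffle_block_def nth_append length_block)
  with i show "block (shuffle_block f k s \<pi>) k t ! i = block \<pi> k t ! i"
    using assms by (simp add: block_def)
qed

lemma shuffle_block_in_perms:
  assumes "\<pi> \<in> perms n" "s + k \<le> n" "f permutes {..<k}"
  shows "shuffle_block f k s \<pi> \<in> perms n"
proof -
  have len: "length (block \<pi> k s) = k"
    using assms by (simp add: length_block length_perms)
  have "mset (shuffle_block f k s \<pi>) = mset (take s \<pi> @ block \<pi> k s @ drop (s + k) \<pi>)"
    using assms(3) len by (simp add: shuffle_block_def)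
  then have "mset (shuffle_block f k s \<pi>) = mset \<pi>"
    by (simp only: append_block)
  then show ?thesis
    using assms(1) by (metis mset_eq_imp_distinct_iff mset_eq_setD permutations_of_setD
        permutations_of_setI)
qed

lemma permute_list_inject:
  assumes "f permutes {..<length xs}" "length ys = length xs"
    and eq: "permute_list f xs = permute_list f ys"
  shows "xs = ys"
proof (rule nth_equalityI)
  fix i assume "i < length xs"
  moreover obtain j where "f j = i" using permutes_surj[OF assms(1)] by (metis surjD)
  moreover have "f j < length xs \<longleftrightarrow> j < length xs"
    using permutes_in_image[OF assms(1)] by simp
  ultimately show "xs ! i = ys ! i"
    using assms by (metis permute_list_nth)
qed (use assms in simp)

lemma inj_on_shuffle_block:
  assumes "s + k \<le> n" "f permutes {..<k}"
  shows "inj_on (shuffle_block f k s) (perms n)"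
proof (rule inj_onI)
  fix \<pi> \<rho> assume "\<pi> \<in> perms n" "\<rho> \<in> perms n"
    and eq: "shuffle_block f k s \<pi> = shuffle_block f k s \<rho>"
  then have len: "length \<pi> = n" "length \<rho> = n" by (simp_all add: length_perms)
  then have lb: "length (block \<pi> k s) = k" "length (block \<rho> k s) = k"
    using assms by (simp_all add: length_block)
  have "take s \<pi> = take s \<rho>" "drop (s + k) \<pi> = drop (s + k) \<rho>"
    "permute_list f (block \<pi> k s) = permute_list f (block \<rho> k s)"
    using eq len lb by (simp_all add: shuffle_block_def)
  moreover from this(3) have "block \<pi> k s = block \<rho> k s"
    using permute_list_inject[of f "block \<pi> k s" "block \<rho> k s"] assms lb by simp
  ultimately show "\<pi> = \<rho>" by (metis append_block)
qed

text \<open>Rearranging the entries inside the block at \<open>s\<close> by the permutation that carries \<open>\<sigma>\<close> to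
  \<open>\<tau>\<close> changes the pattern of that block from \<open>\<sigma>\<close> to \<open>\<tau>\<close> and leaves the other blocks alone.\<close>

lemma card_block_pattern_le:
  assumes sep: "separated k n (insert s S)" and s: "s \<notin> S"
    and \<sigma>: "\<sigma> \<in> patterns k" and \<tau>: "\<tau> \<in> patterns k"
  shows "card {\<pi> \<in> perms n. (\<forall>t\<in>S. pattern (block \<pi> k t) = p t) \<and> pattern (block \<pi> k s) = \<sigma>}
       \<le> card {\<pi> \<in> perms n. (\<forall>t\<in>S. pattern (block \<pi> k t) = p t) \<and> pattern (block \<pi> k s) = \<tau>}"
    (is "card ?A \<le> card ?B")
proof -
  have "mset \<tau> = mset \<sigma>"
    using \<sigma> \<tau> by (metis permutations_of_setD set_eq_iff_mset_eq_distinct)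
  then obtain f where f: "f permutes {..<length \<sigma>}" "permute_list f \<sigma> = \<tau>"
    by (rule mset_eq_permutation)
  have "length \<sigma> = k" using \<sigma> by (simp add: length_finite_permutations_of_set)
  with f have fk: "f permutes {..<k}" by simp
  have sk: "s + k \<le> n" using sep by (simp add: separated_def)
  show ?thesis
  proof (rule card_inj_on_le)
    show "inj_on (shuffle_block f k s) ?A"
      by (rule inj_on_subset[OF inj_on_shuffle_block[OF sk fk]]) auto
    show "shuffle_block f k s ` ?A \<subseteq> ?B"
    proof safe
      fix \<pi> assume \<pi>: "\<pi> \<in> perms n" and p: "\<forall>t\<in>S. pattern (block \<pi> k t) = p t"
        and \<sigma>_def: "\<sigma> = pattern (block \<pi> k s)"
      have len: "length \<pi> = n" using \<pi> by (rule length_perms)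
      show "shuffle_block f k s \<pi> \<in> perms n"
        using \<pi> sk fk by (rule shuffle_block_in_perms)
      show "pattern (block (shuffle_block f k s \<pi>) k s) = \<tau>"
        using sk len f by (simp add: block_shuffle_block_same pattern_permute_list \<sigma>_def)
      fix t assume t: "t \<in> S"
      then have "s \<noteq> t" using s by auto
      then have "block (shuffle_block f k s \<pi>) k t = block \<pi> k t"
        using t sep len by (intro block_shuffle_block_other) (auto simp: separated_def)
      with p t show "pattern (block (shuffle_block f k s \<pi>) k t) = p t" by simp
    qed
  qed simp
qed

text \<open>Each prescription of patterns for the blocks starting in \<open>S\<close> is met by the same fraction
  \<open>1 / (k!) ^ card S\<close> of all permutations. Given the patterns at \<open>S\<close>, all \<open>k!\<close> patterns of one
  further block are equally frequent by \<open>card_block_pattern_le\<close>, used in both directions.\<close>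

lemma card_prescribed_patterns:
  assumes "finite S" "separated k n S" "\<And>s. s \<in> S \<Longrightarrow> p s \<in> patterns k"
  shows "card {\<pi> \<in> perms n. \<forall>s\<in>S. pattern (block \<pi> k s) = p s} * fact k ^ card S = fact n"
  using assms
proof (induction S)
  case empty
  then show ?case by simp
next
  case (insert s S)
  define A where "A \<sigma> = {\<pi> \<in> perms n. (\<forall>t\<in>S. pattern (block \<pi> k t) = p t) \<and>
    pattern (block \<pi> k s) = \<sigma>}" for \<sigma>
  have sk: "s + k \<le> n" using insert.prems by (simp add: separated_def)
  have "separated k n S" using insert.prems by (simp add: separated_def)
  then have IH: "card {\<pi> \<in> perms n. \<forall>t\<in>S. pattern (block \<pi> k t) = p t} * fact k ^ card S = fact n"
    using insert by simp
  have "{\<pi> \<in> perms n. \<forall>t\<in>S. pattern (block \<pi> k t) = p t} = (\<Union>\<sigma>\<in>patterns k. A \<sigma>)"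
    using pattern_block_in_patterns[OF _ sk] by (auto simp: A_def)
  also have "card \<dots> = (\<Sum>\<sigma>\<in>patterns k. card (A \<sigma>))"
    by (rule card_UN_disjoint) (auto simp: A_def)
  also have "\<dots> = (\<Sum>\<sigma>\<in>patterns k. card (A (p s)))"
    unfolding A_def using insert.prems insert.hyps
    by (intro sum.cong antisym card_block_pattern_le) auto
  also have "\<dots> = fact k * card (A (p s))" by simp
  finally have "fact k * card (A (p s)) * fact k ^ card S = fact n"
    using IH by simp
  moreover have "{\<pi> \<in> perms n. \<forall>t\<in>insert s S. pattern (block \<pi> k t) = p t} = A (p s)"
    by (auto simp: A_def)
  ultimately show ?case
    using insert.hyps by (simp add: mult_ac)
qed

section \<open>Block twins as coincidences of patterns\<close>

lemma block_twins_iff_pattern: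
  assumes "\<pi> \<in> perms n" "k \<ge> 1"
  shows "block_twins r k \<pi> S \<longleftrightarrow> finite S \<and> card S = r \<and> separated k n S \<and>
    (\<forall>s\<in>S. \<forall>t\<in>S. pattern (block \<pi> k s) = pattern (block \<pi> k t))"
proof -
  have "distinct \<pi>" using assms by (simp add: permutations_of_setD)
  then have sim: "similar (block \<pi> k s) (block \<pi> k t) \<longleftrightarrow>
      pattern (block \<pi> k s) = pattern (block \<pi> k t)" for s t
    by (simp add: similar_iff_pattern_eq distinct_block)
  have sub: "block_positions k s \<subseteq> {..<length \<pi>} \<longleftrightarrow> s + k \<le> n" for s
  proof -
    have "{s..<s + k} \<subseteq> {..<n} \<longleftrightarrow> s + k \<le> n"
      using assms(2) atLeastLessThan_subset_iff[of s "s + k" 0 n]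
      by (auto simp: lessThan_atLeast0)
    then show ?thesis using assms(1) by (simp add: block_positions_def length_perms)
  qed
  have disj: "block_positions k s \<inter> block_positions k t = {} \<longleftrightarrow> s + k \<le> t \<or> t + k \<le> s" for s t
    using assms(2) by (auto simp: block_positions_def ivl_disj_int_one)
  show ?thesis
    unfolding block_twins_def sim sub disj separated_def using assms(2) by blast
qed

text \<open>Truncating all blocks of a family of block twins gives shorter block twins, so the lengths
  that occur form an initial segment of the positive integers.\<close>

lemma block_twins_shorten:
  assumes "block_twins r k' \<pi> S" "1 \<le> k" "k \<le> k'"
  shows "block_twins r k \<pi> S"
proof -
  have pos: "block_positions k s \<subseteq> block_positions k' s" for s
    using assms(3) by (auto simp: block_positions_def)
  have blk: "block \<pi> k s = take k (block \<pi> k' s)" for s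
    using assms(3) by (simp add: block_def min_absorb1)
  have "similar (take k xs) (take k ys)" if "similar xs ys" for xs ys
    using that by (auto simp: similar_def)
  then have "\<forall>s\<in>S. \<forall>t\<in>S. similar (block \<pi> k s) (block \<pi> k t)"
    using assms(1) by (simp add: block_twins_def blk)
  then show ?thesis
    using assms pos unfolding block_twins_def by blast
qed

lemma le_bt_iff:
  assumes "r \<ge> 1" "k \<ge> 1"
  shows "k \<le> bt r \<pi> \<longleftrightarrow> (\<exists>S. block_twins r k \<pi> S)"
proof -
  let ?K = "{k. \<exists>S. block_twins r k \<pi> S}"
  have "k' \<le> length \<pi>" if "block_twins r k' \<pi> S" for k' S
  proof -
    have "S \<noteq> {}" using that assms(1) by (auto simp: block_twins_def)
    then obtain s where "s \<in> S" by auto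
    with that have "{s..<s + k'} \<subseteq> {..<length \<pi>}"
      by (simp add: block_twins_def block_positions_def)
    then have "card {s..<s + k'} \<le> card {..<length \<pi>}" by (intro card_mono) auto
    then show ?thesis by simp
  qed
  then have fin: "finite (insert 0 ?K)"
    by (intro finite.insertI finite_subset[of ?K "{..length \<pi>}"]) auto
  show ?thesis
  proof
    assume k: "k \<le> bt r \<pi>"
    have "bt r \<pi> \<in> insert 0 ?K"
      unfolding bt_def using fin by (intro Max_in) auto
    with k assms(2) obtain S where "block_twins r (bt r \<pi>) \<pi> S" by auto
    then show "\<exists>S. block_twins r k \<pi> S"
      using k assms(2) block_twins_shorten by blast
  next
    assume "\<exists>S. block_twins r k \<pi> S"
    then show "k \<le> bt r \<pi>"
      unfolding bt_def using fin by (intro Max_ge) auto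
  qed
qed

section \<open>The first moment bound\<close>

lemma binomial_le_power: "n choose r \<le> n ^ r"
proof (cases "r \<le> n")
  case True
  then show ?thesis by (rule binomial_le_pow)
qed (simp add: binomial_eq_0)

text \<open>A union bound over the at most \<open>n\<^sup>r\<close> families of starting positions. For a given family,
  the common pattern can be chosen in \<open>k!\<close> ways, and all \<open>r\<close> blocks have it with probability
  \<open>1 / (k!)\<^sup>r\<close>.\<close>

lemma card_le_bt:
  assumes "r \<ge> 1" "k \<ge> 1"
  shows "card {\<pi> \<in> perms n. k \<le> bt r \<pi>} * fact k ^ (r - 1) \<le> n ^ r * fact n"
proof -
  define F where "F = {S. S \<subseteq> {..<n} \<and> card S = r \<and> separated k n S}"
  define E where "E S \<sigma> = {\<pi> \<in> perms n. \<forall>s\<in>S. pattern (block \<pi> k s) = \<sigma>}" for S \<sigma>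
  have "finite F"
    by (rule finite_subset[of _ "Pow {..<n}"]) (auto simp: F_def)
  have cardE: "card (\<Union>\<sigma>\<in>patterns k. E S \<sigma>) * fact k ^ (r - 1) \<le> fact n" if "S \<in> F" for S
  proof -
    have S: "finite S" "separated k n S" "card S = r"
      using that finite_subset[of S "{..<n}"] by (auto simp: F_def)
    have pow: "fact k ^ r = fact k * (fact k :: nat) ^ (r - 1)"
      using assms(1) by (simp flip: power_Suc)
    have *: "card (E S \<sigma>) * fact k ^ r = fact n" if "\<sigma> \<in> patterns k" for \<sigma>
      using card_prescribed_patterns[OF S(1,2), of "\<lambda>_. \<sigma>"] that S(3) by (simp add: E_def)
    have "fact k * (card (\<Union>\<sigma>\<in>patterns k. E S \<sigma>) * fact k ^ (r - 1))
        = card (\<Union>\<sigma>\<in>patterns k. E S \<sigma>) * fact k ^ r"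
      by (simp add: pow)
    also have "\<dots> \<le> (\<Sum>\<sigma>\<in>patterns k. card (E S \<sigma>)) * fact k ^ r"
      by (intro mult_right_mono card_UN_le) auto
    also have "\<dots> = (\<Sum>\<sigma>\<in>patterns k. card (E S \<sigma>) * fact k ^ r)"
      by (simp add: sum_distrib_right)
    also have "\<dots> = fact k * fact n"
      using * by simp
    finally show ?thesis by simp
  qed
  have "{\<pi> \<in> perms n. k \<le> bt r \<pi>} \<subseteq> (\<Union>S\<in>F. \<Union>\<sigma>\<in>patterns k. E S \<sigma>)"
  proof
    fix \<pi> assume "\<pi> \<in> {\<pi> \<in> perms n. k \<le> bt r \<pi>}"
    then have \<pi>: "\<pi> \<in> perms n" and "k \<le> bt r \<pi>" by auto
    then obtain S where S: "finite S" "card S = r" "separated k n S"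
        "\<forall>s\<in>S. \<forall>t\<in>S. pattern (block \<pi> k s) = pattern (block \<pi> k t)"
      using assms by (auto simp: le_bt_iff block_twins_iff_pattern)
    then obtain s where s: "s \<in> S" using assms(1) by fastforce
    have "s + k \<le> n" using S(3) s by (auto simp: separated_def)
    then have "pattern (block \<pi> k s) \<in> patterns k"
      using \<pi> by (intro pattern_block_in_patterns)
    moreover have "\<pi> \<in> E S (pattern (block \<pi> k s))"
      unfolding E_def using \<pi> S(4) s by blast
    moreover have "S \<in> F"
      using S assms(2) by (force simp: F_def separated_def)
    ultimately show "\<pi> \<in> (\<Union>S\<in>F. \<Union>\<sigma>\<in>patterns k. E S \<sigma>)" by blast
  qed
  then have "card {\<pi> \<in> perms n. k \<le> bt r \<pi>} \<le> card (\<Union>S\<in>F. \<Union>\<sigma>\<in>patterns k. E S \<sigma>)"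
    using \<open>finite F\<close> by (intro card_mono) (auto simp: E_def)
  also have "\<dots> \<le> (\<Sum>S\<in>F. card (\<Union>\<sigma>\<in>patterns k. E S \<sigma>))"
    using \<open>finite F\<close> by (rule card_UN_le)
  finally have "card {\<pi> \<in> perms n. k \<le> bt r \<pi>} * fact k ^ (r - 1)
      \<le> (\<Sum>S\<in>F. card (\<Union>\<sigma>\<in>patterns k. E S \<sigma>) * fact k ^ (r - 1))"
    by (simp add: mult_right_mono flip: sum_distrib_right)
  also have "\<dots> \<le> (\<Sum>S\<in>F. fact n)"
    by (intro sum_mono cardE)
  also have "\<dots> = card F * fact n" by simp
  also have "card F \<le> card {S. S \<subseteq> {..<n} \<and> card S = r}"
    by (rule card_mono[OF finite_subset[of _ "Pow {..<n}"]]) (auto simp: F_def)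
  also have "\<dots> \<le> n ^ r"
    by (simp add: n_subsets binomial_le_power)
  finally show ?thesis by simp
qed

lemma prob_random_permutation:
  "measure_pmf.prob (random_permutation n) {\<pi>. Q \<pi>} = real (card {\<pi> \<in> perms n. Q \<pi>}) / fact n"
proof -
  have "perms n \<inter> {\<pi>. Q \<pi>} = {\<pi> \<in> perms n. Q \<pi>}" by auto
  then show ?thesis
    by (simp add: random_permutation_def measure_pmf_of_set)
qed

lemma prob_le_bt:
  assumes "r \<ge> 1" "k \<ge> 1"
  shows "measure_pmf.prob (random_permutation n) {\<pi>. k \<le> bt r \<pi>} \<le> real n ^ r / fact k ^ (r - 1)"
proof -
  have "real (card {\<pi> \<in> perms n. k \<le> bt r \<pi>}) * fact k ^ (r - 1) \<le> real n ^ r * fact n"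
    using card_le_bt[OF assms, of n, THEN of_nat_mono[where 'a = real]] by simp
  then show ?thesis
    unfolding prob_random_permutation by (simp add: field_simps)
qed

section \<open>Words without a frequent letter\<close>

definition sparse_maps :: "nat \<Rightarrow> 'a set \<Rightarrow> 'b set \<Rightarrow> ('a \<Rightarrow> 'b) set" where
  "sparse_maps r A B = {f \<in> A \<rightarrow>\<^sub>E B. \<forall>b\<in>B. card {a \<in> A. f a = b} < r}"

lemma finite_sparse_maps: "finite A \<Longrightarrow> finite B \<Longrightarrow> finite (sparse_maps r A B)"
  unfolding sparse_maps_def by (rule finite_subset[OF _ finite_PiE[of A "\<lambda>_. B"]]) auto

text \<open>A sparse map is determined by the fibre \<open>T\<close> over the new value \<open>b\<close> and by its restriction to
  the complement of \<open>T\<close>, which is again sparse.\<close>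

lemma card_sparse_maps_insert_le:
  assumes "finite A" "finite B" "b \<notin> B"
  shows "card (sparse_maps r A (insert b B))
    \<le> (\<Sum>T | T \<subseteq> A \<and> card T < r. card (sparse_maps r (A - T) B))"
proof -
  define fib where "fib f = {a \<in> A. f a = b}" for f
  define M where "M T = {f \<in> sparse_maps r A (insert b B). fib f = T}" for T
  let ?I = "{T. T \<subseteq> A \<and> card T < r}"
  have fin: "finite ?I"
    by (rule finite_subset[of _ "Pow A"]) (use assms in auto)
  have "card (M T) \<le> card (sparse_maps r (A - T) B)" for T
  proof (rule card_inj_on_le)
    show "inj_on (\<lambda>f. restrict f (A - T)) (M T)"
    proof (rule inj_onI)
      fix f g assume fg: "f \<in> M T" "g \<in> M T" and eq: "restrict f (A - T) = restrict g (A - T)"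
      show "f = g"
      proof (rule PiE_ext)
        show "f \<in> A \<rightarrow>\<^sub>E insert b B" "g \<in> A \<rightarrow>\<^sub>E insert b B"
          using fg by (auto simp: M_def sparse_maps_def)
        fix a assume a: "a \<in> A"
        show "f a = g a"
        proof (cases "a \<in> T")
          case True
          then have "f a = b" "g a = b" using fg unfolding M_def fib_def by blast+
          then show ?thesis by simp
        next
          case False
          then show ?thesis using fun_cong[OF eq, of a] a by simp
        qed
      qed
    qed
    show "(\<lambda>f. restrict f (A - T)) ` M T \<subseteq> sparse_maps r (A - T) B"
    proof (rule image_subsetI)
      fix f assume f: "f \<in> M T"
      have "card {a \<in> A - T. restrict f (A - T) a = c} < r" if "c \<in> B" for c
      proof -
        have "card {a \<in> A - T. restrict f (A - T) a = c} \<le> card {a \<in> A. f a = c}"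
          using assms(1) by (intro card_mono) auto
        also have "\<dots> < r"
          using f that by (auto simp: M_def sparse_maps_def)
        finally show ?thesis .
      qed
      moreover have "restrict f (A - T) \<in> A - T \<rightarrow>\<^sub>E B"
        using f by (auto simp: M_def sparse_maps_def fib_def)
      ultimately show "restrict f (A - T) \<in> sparse_maps r (A - T) B"
        by (simp add: sparse_maps_def)
    qed
  qed (use assms in \<open>simp add: finite_sparse_maps\<close>)
  moreover have "sparse_maps r A (insert b B) = (\<Union>T\<in>?I. M T)"
    by (auto simp: M_def sparse_maps_def fib_def)
  ultimately show ?thesis
    using order_trans[OF card_UN_le[OF fin, of M] sum_mono] by simp
qed

lemma sum_subsets_by_card:
  fixes g :: "nat \<Rightarrow> real"
  assumes "finite A"
  shows "(\<Sum>T | T \<subseteq> A \<and> card T < r. g (card T)) = (\<Sum>i<r. real (card A choose i) * g i)"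
proof -
  let ?I = "{T. T \<subseteq> A \<and> card T < r}"
  have "finite ?I"
    by (rule finite_subset[of _ "Pow A"]) (use assms in auto)
  then have "(\<Sum>T\<in>?I. g (card T)) = (\<Sum>i<r. \<Sum>T\<in>{T \<in> ?I. card T = i}. g (card T))"
    by (intro sum.group[symmetric]) auto
  also have "\<dots> = (\<Sum>i<r. real (card A choose i) * g i)"
  proof (rule sum.cong)
    fix i assume "i \<in> {..<r}"
    then have "{T \<in> ?I. card T = i} = {T. T \<subseteq> A \<and> card T = i}" by auto
    then show "(\<Sum>T\<in>{T \<in> ?I. card T = i}. g (card T)) = real (card A choose i) * g i"
      using n_subsets[OF assms] by simp
  qed simp
  finally show ?thesis .
qed

text \<open>The number of words of length \<open>m\<close> over \<open>N\<close> letters, none of them used \<open>r\<close> or more times, is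
  \<open>m!\<close> times the coefficient of \<open>x\<^sup>m\<close> in \<open>P(x)\<^sup>N\<close>, where \<open>P\<close> is the exponential series truncated
  before \<open>x\<^sup>r\<close>. As \<open>P\<close> has nonnegative coefficients, that coefficient is at most
  \<open>P(x)\<^sup>N / x\<^sup>m\<close> for each \<open>x > 0\<close>. The induction splits off the letters one by one.\<close>

lemma card_sparse_maps_le:
  fixes x :: real and A :: "'a set" and B :: "'b set"
  assumes "finite B" "finite A" "x \<ge> 0"
  shows "real (card (sparse_maps r A B)) * x ^ card A
    \<le> fact (card A) * (\<Sum>i<r. x ^ i / fact i) ^ card B"
  using assms
proof (induction B arbitrary: A)
  case empty
  show ?case
  proof (cases "A = {}")
    case True
    then show ?thesis by (simp add: sparse_maps_def)
  next
    case False
    then have "sparse_maps r A ({} :: 'b set) = {}"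
      by (auto simp: sparse_maps_def)
    then show ?thesis by simp
  qed
next
  case (insert b B)
  define P where "P = (\<Sum>i<r. x ^ i / fact i)"
  let ?m = "card A"
  let ?I = "{T. T \<subseteq> A \<and> card T < r}"
  have "real (card (sparse_maps r A (insert b B))) * x ^ ?m
      \<le> real (\<Sum>T\<in>?I. card (sparse_maps r (A - T) B)) * x ^ ?m"
    using insert by (intro mult_right_mono of_nat_mono card_sparse_maps_insert_le) auto
  also have "\<dots> = (\<Sum>T\<in>?I. real (card (sparse_maps r (A - T) B)) * x ^ ?m)"
    by (simp add: sum_distrib_right)
  also have "\<dots> \<le> (\<Sum>T\<in>?I. x ^ card T * (fact (?m - card T) * P ^ card B))"
  proof (rule sum_mono)
    fix T assume "T \<in> ?I"
    then have T: "T \<subseteq> A" by simp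
    have cardAT: "card (A - T) = ?m - card T" and le: "card T \<le> ?m"
      using T insert.prems by (simp_all add: card_Diff_subset finite_subset card_mono)
    have "real (card (sparse_maps r (A - T) B)) * x ^ ?m
        = x ^ card T * (real (card (sparse_maps r (A - T) B)) * x ^ card (A - T))"
      using le by (simp add: cardAT flip: power_add)
    also have "\<dots> \<le> x ^ card T * (fact (card (A - T)) * P ^ card B)"
      unfolding P_def using insert by (intro mult_left_mono insert.IH) auto
    finally show "real (card (sparse_maps r (A - T) B)) * x ^ ?m
        \<le> x ^ card T * (fact (?m - card T) * P ^ card B)"
      by (simp add: cardAT)
  qed
  also have "\<dots> = (\<Sum>i<r. real (?m choose i) * (x ^ i * (fact (?m - i) * P ^ card B)))"
    using insert.prems by (intro sum_subsets_by_card) auto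
  also have "\<dots> \<le> (\<Sum>i<r. fact ?m * P ^ card B * (x ^ i / fact i))"
  proof (rule sum_mono)
    fix i
    have "0 \<le> P" using insert.prems by (auto simp: P_def intro!: sum_nonneg)
    show "real (?m choose i) * (x ^ i * (fact (?m - i) * P ^ card B))
        \<le> fact ?m * P ^ card B * (x ^ i / fact i)"
    proof (cases "i \<le> ?m")
      case True
      then show ?thesis by (simp add: binomial_fact mult_ac)
    next
      case False
      then show ?thesis using \<open>0 \<le> P\<close> insert.prems by (simp add: binomial_eq_0)
    qed
  qed
  also have "\<dots> = fact ?m * P ^ card (insert b B)"
    unfolding sum_distrib_left[symmetric] P_def[symmetric] using insert.hyps by (simp add: mult_ac)
  finally show ?case by (simp add: P_def)
qed

section \<open>Consecutive blocks as balls in bins\<close>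

text \<open>If \<open>r\<close> of the consecutive blocks starting at the multiples of \<open>k\<close> shared a pattern, they
  would be block twins; hence the map from blocks to patterns is sparse. By independence, each
  such map arises from a \<open>1 / (k!)\<^sup>m\<close> fraction of the permutations.\<close>

lemma card_bt_less:
  assumes "r \<ge> 1" "k \<ge> 1" "m * k \<le> n" and A: "A = (\<lambda>i. i * k) ` {..<m}"
  shows "card {\<pi> \<in> perms n. bt r \<pi> < k} * fact k ^ m
    \<le> card (sparse_maps r A (patterns k)) * fact n"
proof -
  define E where "E f = {\<pi> \<in> perms n. \<forall>s\<in>A. pattern (block \<pi> k s) = f s}" for f
  let ?M = "sparse_maps r A (patterns k)"
  have finA: "finite A" and cardA: "card A = m"
    using assms(2) by (simp_all add: A card_image inj_on_def)
  have sepA: "separated k n A"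
    unfolding separated_def
  proof (intro conjI ballI impI)
    fix s assume "s \<in> A"
    then obtain i where i: "i < m" "s = i * k" by (auto simp: A)
    then have "Suc i * k \<le> m * k" by (intro mult_right_mono) auto
    then show "s + k \<le> n" using i assms(3) by simp
    fix t assume "t \<in> A" "s \<noteq> t"
    then obtain j where j: "j < m" "t = j * k" "i \<noteq> j" using i by (auto simp: A)
    have "Suc i * k \<le> j * k \<or> Suc j * k \<le> i * k"
      using j(3) by (cases "i < j") (auto intro: mult_right_mono simp del: mult_Suc)
    then show "s + k \<le> t \<or> t + k \<le> s" using i j by (simp add: add.commute)
  qed
  have cardE: "card (E f) * fact k ^ m = fact n" if "f \<in> ?M" for f
    using card_prescribed_patterns[OF finA sepA, of f] that
    by (auto simp: E_def cardA sparse_maps_def)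
  have finM: "finite ?M" by (simp add: finite_sparse_maps finA)
  have "{\<pi> \<in> perms n. bt r \<pi> < k} \<subseteq> (\<Union>f\<in>?M. E f)"
  proof
    fix \<pi> assume "\<pi> \<in> {\<pi> \<in> perms n. bt r \<pi> < k}"
    then have \<pi>: "\<pi> \<in> perms n" and less: "bt r \<pi> < k" by auto
    define f where "f = restrict (\<lambda>s. pattern (block \<pi> k s)) A"
    have "f \<in> A \<rightarrow>\<^sub>E patterns k"
      using sepA by (auto simp: f_def separated_def intro: pattern_block_in_patterns[OF \<pi>])
    moreover have "card {s \<in> A. f s = \<sigma>} < r" for \<sigma>
    proof (rule ccontr)
      assume "\<not> card {s \<in> A. f s = \<sigma>} < r"
      then obtain S where S: "S \<subseteq> {s \<in> A. f s = \<sigma>}" "card S = r" "finite S"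
        by (meson not_less obtain_subset_with_card_n)
      have "block_twins r k \<pi> S"
        unfolding block_twins_iff_pattern[OF \<pi> assms(2)]
      proof (intro conjI ballI)
        show "separated k n S"
          using S(1) sepA unfolding separated_def by blast
        have "pattern (block \<pi> k s) = \<sigma>" if "s \<in> S" for s
          using that S(1) by (auto simp: f_def)
        then show "pattern (block \<pi> k s) = pattern (block \<pi> k t)" if "s \<in> S" "t \<in> S" for s t
          using that by simp
      qed (use S in auto)
      then show False
        using less le_bt_iff[OF assms(1,2), of \<pi>] by auto
    qed
    ultimately have "f \<in> ?M" by (simp add: sparse_maps_def)
    moreover have "\<pi> \<in> E f" using \<pi> by (simp add: E_def f_def)
    ultimately show "\<pi> \<in> (\<Union>f\<in>?M. E f)" by blast
  qed
  then have "card {\<pi> \<in> perms n. bt r \<pi> < k} \<le> card (\<Union>f\<in>?M. E f)"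
    using finM by (intro card_mono) (auto simp: E_def)
  also have "\<dots> \<le> (\<Sum>f\<in>?M. card (E f))"
    using finM by (rule card_UN_le)
  finally have "card {\<pi> \<in> perms n. bt r \<pi> < k} * fact k ^ m \<le> (\<Sum>f\<in>?M. card (E f) * fact k ^ m)"
    by (simp flip: sum_distrib_right)
  also have "\<dots> = card ?M * fact n" using cardE by simp
  finally show ?thesis .
qed

text \<open>A crude form of Stirling's formula. The induction step is \<open>e m\<^sup>m\<^sup>+\<^sup>1 \<le> (m + 1)\<^sup>m\<^sup>+\<^sup>1\<close>, which
  is \<open>1 - 1 / (m + 1) \<le> exp (-1 / (m + 1))\<close> raised to the power \<open>m + 1\<close>.\<close>

lemma fact_exp_le:
  assumes "m \<ge> 1"
  shows "fact m * exp (real m) \<le> exp 1 * real m * real m ^ m"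
  using assms
proof (induction m rule: nat_induct_at_least)
  case base
  then show ?case by simp
next
  case (Suc m)
  have "(real m / real (Suc m)) ^ Suc m \<le> exp (- 1 / real (Suc m)) ^ Suc m"
    using exp_ge_add_one_self[of "- 1 / real (Suc m)"] by (intro power_mono) (auto simp: field_simps)
  also have "\<dots> = exp (- 1)"
    by (simp only: exp_of_nat_mult[symmetric]) simp
  finally have "real m ^ Suc m \<le> exp (- 1) * real (Suc m) ^ Suc m"
    unfolding power_divide by (subst (asm) pos_divide_le_eq) auto
  then have step: "exp 1 * real m ^ Suc m \<le> real (Suc m) ^ Suc m"
    using mult_left_mono[of "real m ^ Suc m" "exp (- 1) * real (Suc m) ^ Suc m" "exp 1"]
    by (simp only: mult.assoc[symmetric] exp_add[symmetric]) simp
  have "fact (Suc m) * exp (real (Suc m)) = real (Suc m) * exp 1 * (fact m * exp (real m))"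
    by (simp add: exp_add algebra_simps)
  also have "\<dots> \<le> real (Suc m) * exp 1 * (exp 1 * real m * real m ^ m)"
    using Suc.IH by (intro mult_left_mono) auto
  also have "\<dots> = exp 1 * real (Suc m) * (exp 1 * real m ^ Suc m)"
    by simp
  also have "\<dots> \<le> exp 1 * real (Suc m) * real (Suc m) ^ Suc m"
    by (intro mult_left_mono step) auto
  finally show ?case .
qed

text \<open>Dropping the term of degree \<open>r\<close> from the exponential series lowers its value by the factor
  \<open>1 - x\<^sup>r e\<^sup>-\<^sup>x / r!\<close> or more, and \<open>e\<^sup>-\<^sup>x \<ge> 1 / e\<close> on the unit interval.\<close>

lemma truncated_exp_le:
  fixes x :: real
  assumes "0 \<le> x" "x \<le> 1"
  shows "(\<Sum>i<r. x ^ i / fact i) \<le> exp (x - x ^ r / (exp 1 * fact r))"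
proof -
  have "(\<Sum>i<Suc r. x ^ i / fact i) \<le> exp x"
    using sum_le_suminf[OF summable_exp_generic, of "{..<Suc r}" x] assms
    by (simp add: exp_def scaleR_conv_of_real divide_inverse mult.commute)
  then have "(\<Sum>i<r. x ^ i / fact i) \<le> exp x - x ^ r / fact r" by simp
  also have "\<dots> = exp x * (1 - x ^ r / (exp x * fact r))"
    by (simp add: field_simps)
  also have "\<dots> \<le> exp x * (1 - x ^ r / (exp 1 * fact r))"
    using assms by (intro mult_left_mono diff_left_mono divide_left_mono mult_right_mono) auto
  also have "\<dots> \<le> exp x * exp (- (x ^ r / (exp 1 * fact r)))"
    using exp_ge_add_one_self[of "- (x ^ r / (exp 1 * fact r))"] by (intro mult_left_mono) auto
  also have "\<dots> = exp (x - x ^ r / (exp 1 * fact r))"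
    by (simp flip: exp_add)
  finally show ?thesis .
qed

text \<open>With \<open>x = m / N\<close> and \<open>N = k!\<close>, the generating function bound reads
  \<open>(m! e\<^sup>m / m\<^sup>m) * (P(x) e\<^sup>-\<^sup>x)\<^sup>N\<close>. The first factor is at most \<open>e m\<close>, and \<open>P(x) e\<^sup>-\<^sup>x\<close>, the
  probability that a Poisson variable of mean \<open>x\<close> stays below \<open>r\<close>, is at most
  \<open>exp (- x\<^sup>r / (e r!))\<close>. The assumption \<open>m \<le> k!\<close> makes \<open>x \<le> 1\<close>, which keeps \<open>e\<^sup>-\<^sup>x\<close> away
  from 0.\<close>

lemma prob_bt_less:
  assumes "r \<ge> 1" "k \<ge> 1" "m * k \<le> n" "m \<ge> 1" "m \<le> fact k"
  shows "measure_pmf.prob (random_permutation n) {\<pi>. bt r \<pi> < k}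
    \<le> exp 1 * real m * exp (- (real m ^ r / fact k ^ (r - 1)) / (exp 1 * fact r))"
proof -
  define N :: real where "N = fact k"
  define x where "x = real m / N"
  define A where "A = (\<lambda>i. i * k) ` {..<m}"
  define c where "c = real (card (sparse_maps r A (patterns k)))"
  have N: "N > 0" "N \<noteq> 0" by (simp_all add: N_def)
  have "real m \<le> N"
    using of_nat_mono[OF assms(5), where 'a = real] by (simp add: N_def)
  then have x: "0 \<le> x" "x \<le> 1" using N by (simp_all add: x_def)
  have Nx: "N * x = real m" using N by (simp add: x_def)
  have A: "finite A" "card A = m"
    using assms(2) by (simp_all add: A_def card_image inj_on_def)
  have "real (card {\<pi> \<in> perms n. bt r \<pi> < k}) * N ^ m \<le> c * fact n"
    using card_bt_less[OF assms(1-3) A_def, THEN of_nat_mono[where 'a = real]]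
    by (simp add: N_def c_def)
  then have "real (card {\<pi> \<in> perms n. bt r \<pi> < k}) / fact n \<le> c / N ^ m"
    using N by (simp add: field_simps)
  also have "\<dots> = c * x ^ m / real m ^ m"
    using N assms(4) by (simp add: x_def power_divide)
  also have "c * x ^ m \<le> fact m * (\<Sum>i<r. x ^ i / fact i) ^ fact k"
    using card_sparse_maps_le[of "patterns k" A x r] A x by (simp add: c_def)
  also have "(\<Sum>i<r. x ^ i / fact i) ^ fact k \<le> exp (x - x ^ r / (exp 1 * fact r)) ^ fact k"
    using x by (intro power_mono truncated_exp_le sum_nonneg) auto
  also have "\<dots> = exp (N * (x - x ^ r / (exp 1 * fact r)))"
    by (simp add: N_def flip: exp_of_nat_mult)
  also have "N * (x - x ^ r / (exp 1 * fact r)) = real m + - (N * x ^ r) / (exp 1 * fact r)"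
    by (simp add: right_diff_distrib Nx)
  also have "N * x ^ r = real m ^ r / fact k ^ (r - 1)"
    using assms(1) N by (cases r) (simp_all add: x_def N_def power_divide)
  also have "fact m * exp (real m + - (real m ^ r / fact k ^ (r - 1)) / (exp 1 * fact r)) / real m ^ m
      = fact m * exp (real m) / real m ^ m * exp (- (real m ^ r / fact k ^ (r - 1)) / (exp 1 * fact r))"
    by (simp only: exp_add) simp
  also have "fact m * exp (real m) / real m ^ m \<le> exp 1 * real m"
    using fact_exp_le[OF assms(4)] assms(4) by (simp add: field_simps)
  finally show ?thesis
    unfolding prob_random_permutation by (simp add: divide_right_mono mult_left_mono)
qed

section \<open>Asymptotics\<close>

definition rate :: "real \<Rightarrow> real" where
  "rate x = ln x / ln (ln x)"

text \<open>Since \<open>ln (rate x)\<close> is asymptotically \<open>ln (ln x)\<close>, the factorial of \<open>y * rate n\<close> is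
  \<open>n\<close> to the power \<open>y + o(1)\<close>. In this form the first limit concerns the lower bound
  \<open>(u / e)\<^sup>u\<close> for factorials and the second the upper bound \<open>v\<^sup>v\<close>, where \<open>v = u + 1\<close>
  leaves room for rounding up.\<close>

lemma rate_entropy_lower:
  "y > 0 \<Longrightarrow> ((\<lambda>x. y * rate x * (ln (y * rate x) - 1) / ln x) \<longlongrightarrow> y) at_top"
  unfolding rate_def by real_asymp

lemma rate_entropy_upper:
  "y > 0 \<Longrightarrow> ((\<lambda>x. (y * rate x + 1) * ln (y * rate x + 1) / ln x) \<longlongrightarrow> y) at_top"
  unfolding rate_def by real_asymp

text \<open>Cutting \<open>n\<close> positions into blocks of length about \<open>y * rate n\<close> gives \<open>n\<close> to the power
  \<open>1 - o(1)\<close> blocks: the block length costs nothing on the logarithmic scale.\<close>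

lemma ln_blocks_rate:
  "y > 0 \<Longrightarrow> ((\<lambda>x. ln (x / (y * rate x + 1) - 1) / ln x) \<longlongrightarrow> 1) at_top"
  unfolding rate_def by real_asymp

lemma rate_at_top: "y > 0 \<Longrightarrow> filterlim (\<lambda>x. y * rate x) at_top at_top"
  unfolding rate_def by real_asymp

lemma rate_sublinear: "y > 0 \<Longrightarrow> eventually (\<lambda>x. 1 < x / (y * rate x + 1) - 1) at_top"
  unfolding rate_def by real_asymp

text \<open>The exponential series at \<open>u\<close> dominates its \<open>k\<close>-th term, and \<open>u\<^sup>k \<ge> u\<^sup>u\<close>.\<close>

lemma fact_ge_exp:
  assumes "1 \<le> u" "u \<le> real k"
  shows "exp (u * (ln u - 1)) \<le> fact k"
proof -
  have "(\<Sum>i\<in>{k}. u ^ i / fact i) \<le> exp u"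
    using sum_le_suminf[OF summable_exp_generic, of "{k}" u] assms
    by (simp add: exp_def scaleR_conv_of_real divide_inverse mult.commute)
  then have "u ^ k \<le> exp u * fact k" by (simp add: field_simps)
  moreover have "exp (u * ln u) \<le> u ^ k"
  proof -
    have "exp (u * ln u) \<le> exp (real k * ln u)" using assms by (simp add: mult_right_mono)
    also have "\<dots> = u ^ k" using assms by (simp add: exp_of_nat_mult)
    finally show ?thesis .
  qed
  ultimately have "exp (u * ln u) / exp u \<le> exp u * fact k / exp u"
    by (intro divide_right_mono) auto
  then show ?thesis by (simp add: exp_diff right_diff_distrib)
qed

lemma fact_le_exp:
  assumes "1 \<le> k" "real k \<le> v"
  shows "fact k \<le> exp (v * ln v)"
proof -
  have "fact k \<le> real k ^ k"
    using fact_le_power[of k, where 'a = real] by simp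
  also have "\<dots> = exp (real k * ln (real k))"
    using assms by (simp add: exp_of_nat_mult)
  also have "\<dots> \<le> exp (v * ln v)"
    using assms by (simp add: mult_mono)
  finally show ?thesis .
qed

lemmas real_to_nat_tendsto = filterlim_compose[OF _ filterlim_real_sequentially]
lemmas real_to_nat_eventually = eventually_compose_filterlim[OF _ filterlim_real_sequentially]

text \<open>The first moment \<open>n\<^sup>r / (k!)\<^sup>r\<^sup>-\<^sup>1\<close> is \<open>n\<close> to the power
  \<open>r - (r - 1) y + o(1)\<close>, which is negative exactly when \<open>y > r / (r - 1)\<close>.\<close>

lemma upper_tail:
  assumes r: "r \<ge> 2" and y: "real r / (real r - 1) < y"
  shows "(\<lambda>n. measure_pmf.prob (random_permutation n) {\<pi>. y * rate (real n) < real (bt r \<pi>)})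
    \<longlonglongrightarrow> 0"
proof (rule tendsto_sandwich[OF _ _ tendsto_const])
  have y0: "y > 0" and gap: "real r - (real r - 1) * y < 0"
    using y r by (auto simp: field_simps intro: less_trans[OF _ y])
  define q where "q x = y * rate x * (ln (y * rate x) - 1) / ln x" for x
  define b where "b x = exp ((real r - (real r - 1) * q x) * ln x)" for x
  have "((\<lambda>x. real r - (real r - 1) * q x) \<longlongrightarrow> real r - (real r - 1) * y) at_top"
    unfolding q_def by (intro tendsto_intros rate_entropy_lower y0)
  then have "(b \<longlongrightarrow> 0) at_top"
    unfolding b_def
    by (intro filterlim_compose[OF exp_at_bot]
        filterlim_tendsto_neg_mult_at_bot[OF _ gap ln_at_top])
  then show "(\<lambda>n. b (real n)) \<longlonglongrightarrow> 0"
    by (rule real_to_nat_tendsto)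
  have "eventually (\<lambda>x. 1 \<le> y * rate x \<and> 1 < x) at_top"
    using rate_at_top[OF y0] eventually_gt_at_top[of 1]
    by (auto simp: filterlim_at_top eventually_conj_iff)
  then have "eventually (\<lambda>n. 1 \<le> y * rate (real n) \<and> 1 < real n) sequentially"
    by (rule real_to_nat_eventually)
  then show "eventually (\<lambda>n. measure_pmf.prob (random_permutation n)
      {\<pi>. y * rate (real n) < real (bt r \<pi>)} \<le> b (real n)) sequentially"
  proof eventually_elim
    case (elim n)
    define u where "u = y * rate (real n)"
    define k where "k = nat \<lfloor>u\<rfloor> + 1"
    have u: "1 \<le> u" "u \<le> real k" using elim by (auto simp: u_def k_def) linarith
    have "measure_pmf.prob (random_permutation n) {\<pi>. u < real (bt r \<pi>)}
        \<le> measure_pmf.prob (random_permutation n) {\<pi>. k \<le> bt r \<pi>}"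
    proof (intro measure_pmf.finite_measure_mono subsetI)
      fix \<pi> assume "\<pi> \<in> {\<pi>. u < real (bt r \<pi>)}"
      then show "\<pi> \<in> {\<pi>. k \<le> bt r \<pi>}" using u(1) by (simp add: k_def) linarith
    qed simp
    also have "\<dots> \<le> real n ^ r / fact k ^ (r - 1)"
      using r by (intro prob_le_bt) (auto simp: k_def)
    also have "\<dots> \<le> real n ^ r / exp (u * (ln u - 1)) ^ (r - 1)"
      using u by (intro divide_left_mono power_mono fact_ge_exp) auto
    also have "\<dots> = exp (real r * ln (real n) - (real r - 1) * (u * (ln u - 1)))"
    proof -
      have "real n ^ r = exp (real r * ln (real n))"
        using elim by (simp add: exp_of_nat_mult)
      moreover have "exp (u * (ln u - 1)) ^ (r - 1) = exp ((real r - 1) * (u * (ln u - 1)))"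
        using r exp_of_nat_mult[of "r - 1" "u * (ln u - 1)"] by (simp add: of_nat_diff)
      ultimately show ?thesis by (simp add: exp_diff)
    qed
    also have "real r * ln (real n) - (real r - 1) * (u * (ln u - 1))
        = (real r - (real r - 1) * q (real n)) * ln (real n)"
    proof -
      have "q (real n) * ln (real n) = u * (ln u - 1)"
        using elim by (simp add: q_def u_def)
      then show ?thesis by (simp only: left_diff_distrib mult.assoc)
    qed
    finally show ?case by (simp add: b_def u_def)
  qed
qed auto

text \<open>Here \<open>m\<^sup>r / (k!)\<^sup>r\<^sup>-\<^sup>1\<close> is \<open>n\<close> to the positive power \<open>r - (r - 1) y + o(1)\<close>, so the
  exponential in \<open>prob_bt_less\<close> beats the linear factor in front of it. The condition
  \<open>y > 1\<close> makes \<open>k!\<close> exceed \<open>n\<close>, hence there are at least as many patterns as blocks.\<close>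

lemma lower_tail:
  assumes r: "r \<ge> 2" and y: "1 < y" "y < real r / (real r - 1)"
  shows "(\<lambda>n. measure_pmf.prob (random_permutation n) {\<pi>. real (bt r \<pi>) < y * rate (real n)})
    \<longlonglongrightarrow> 0"
proof (rule tendsto_sandwich[OF _ _ tendsto_const])
  have y0: "y > 0" using y by simp
  have gap: "real r - (real r - 1) * y > 0"
    using y r by (auto simp: field_simps)
  \<comment> \<open>Half of the limiting exponent, so that \<open>g\<close>, which tends to all of it, eventually exceeds
      \<open>\<delta>\<close>.\<close>
  define \<delta> where "\<delta> = (real r - (real r - 1) * y) / 2"
  define K :: real where "K = exp 1 * fact r"
  define v where "v x = y * rate x + 1" for x
  define g where "g x = real r * (ln (x / v x - 1) / ln x)
    - (real r - 1) * (v x * ln (v x) / ln x)" for x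
  define b where "b x = exp 1 * x * exp (- (exp (\<delta> * ln x) / K))" for x
  have pos: "\<delta> > 0" "K > 0" using gap by (simp_all add: \<delta>_def K_def)
  then have "(b \<longlongrightarrow> 0) at_top"
    unfolding b_def by real_asymp
  then show "(\<lambda>n. b (real n)) \<longlonglongrightarrow> 0"
    by (rule real_to_nat_tendsto)
  have g: "(g \<longlongrightarrow> real r * 1 - (real r - 1) * y) at_top"
    unfolding g_def v_def by (intro tendsto_intros rate_entropy_upper ln_blocks_rate y0)
  have ev1: "eventually (\<lambda>x. \<delta> < g x) at_top"
  proof (rule order_tendstoD(1)[OF g])
    have "\<delta> < 2 * \<delta>" using pos by simp
    also have "\<dots> = real r * 1 - (real r - 1) * y" by (simp add: \<delta>_def)
    finally show "\<delta> < real r * 1 - (real r - 1) * y" .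
  qed
  have ev2: "eventually (\<lambda>x. 1 < y * rate x * (ln (y * rate x) - 1) / ln x) at_top"
    using order_tendstoD(1)[OF rate_entropy_lower[OF y0]] y(1) by blast
  have ev3: "eventually (\<lambda>x. 1 \<le> y * rate x) at_top"
    using rate_at_top[OF y0] by (simp add: filterlim_at_top)
  have "eventually (\<lambda>x. \<delta> < g x \<and> 1 < y * rate x * (ln (y * rate x) - 1) / ln x \<and>
      1 \<le> y * rate x \<and> 1 < x / v x - 1 \<and> 1 < x) at_top"
    unfolding v_def
    by (intro eventually_conj ev1 ev2 ev3 rate_sublinear y0 eventually_gt_at_top)
  then have "eventually (\<lambda>n. \<delta> < g (real n) \<and>
      1 < y * rate (real n) * (ln (y * rate (real n)) - 1) / ln (real n) \<and>
      1 \<le> y * rate (real n) \<and> 1 < real n / v (real n) - 1 \<and> 1 < real n) sequentially"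
    by (rule real_to_nat_eventually)
  then show "eventually (\<lambda>n. measure_pmf.prob (random_permutation n)
      {\<pi>. real (bt r \<pi>) < y * rate (real n)} \<le> b (real n)) sequentially"
  proof eventually_elim
    case (elim n)
    define u where "u = y * rate (real n)"
    define w where "w = v (real n)"
    define L where "L = ln (real n)"
    define k where "k = nat \<lceil>u\<rceil>"
    define m where "m = n div k"
    have L: "L > 0" using elim by (simp add: L_def)
    have w: "w = u + 1" by (simp add: w_def v_def u_def)
    have u: "1 \<le> u" using elim by (simp add: u_def)
    then have k: "1 \<le> k" "u \<le> real k" "real k \<le> w"
      unfolding k_def w by linarith+
    have "n < (m + 1) * k"
      using k(1) by (simp add: m_def dividend_less_div_times)
    then have "real n < (real m + 1) * real k"
      using of_nat_mono[where 'a = real] by (metis of_nat_1 of_nat_add of_nat_less_iff of_nat_mult)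
    also have "\<dots> \<le> (real m + 1) * w" using k by (intro mult_left_mono) auto
    finally have "real n / w < real m + 1"
      using u by (simp add: w field_simps)
    then have m_ge: "real n / w - 1 \<le> real m" by simp
    have big: "1 < real n / w - 1" using elim by (simp add: w_def)
    have m1: "m \<ge> 1" using big m_ge by linarith
    have "real m \<le> real n" by (simp add: m_def)
    also have "real n = exp L" using elim by (simp add: L_def)
    also have "\<dots> \<le> exp (u * (ln u - 1))"
    proof -
      have "1 < u * (ln u - 1) / L"
        unfolding u_def L_def using elim by blast
      then have "L < u * (ln u - 1)"
        using L by (simp only: less_divide_eq_1_pos)
      then show ?thesis by simp
    qed
    also have "\<dots> \<le> fact k"
      using u k by (intro fact_ge_exp) auto
    finally have m_le: "m \<le> fact k" by (metis of_nat_fact of_nat_le_iff)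
    have ratio: "exp (\<delta> * L) \<le> real m ^ r / fact k ^ (r - 1)"
    proof -
      have "\<delta> * L \<le> g (real n) * L" using elim L by simp
      also have "\<dots> = real r * ln (real n / w - 1) - (real r - 1) * (w * ln w)"
      proof -
        have "g (real n) = (real r * ln (real n / w - 1) - (real r - 1) * (w * ln w)) / L"
          by (simp add: g_def w_def L_def diff_divide_distrib)
        then show ?thesis using L by simp
      qed
      finally have "exp (\<delta> * L) \<le> exp (real r * ln (real n / w - 1) - (real r - 1) * (w * ln w))"
        by simp
      also have "\<dots> = (real n / w - 1) ^ r / exp (w * ln w) ^ (r - 1)"
      proof -
        have "(real n / w - 1) ^ r = exp (real r * ln (real n / w - 1))"
          using big by (simp add: exp_of_nat_mult)
        moreover have "exp (w * ln w) ^ (r - 1) = exp ((real r - 1) * (w * ln w))"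
          using r exp_of_nat_mult[of "r - 1" "w * ln w"] by (simp add: of_nat_diff)
        ultimately show ?thesis by (simp add: exp_diff)
      qed
      also have "\<dots> \<le> real m ^ r / fact k ^ (r - 1)"
      proof -
        have "0 \<le> real n / w - 1" using big by linarith
        then show ?thesis
          using k by (intro frac_le power_mono m_ge fact_le_exp) auto
      qed
      finally show ?thesis .
    qed
    have "measure_pmf.prob (random_permutation n) {\<pi>. real (bt r \<pi>) < u}
        \<le> measure_pmf.prob (random_permutation n) {\<pi>. bt r \<pi> < k}"
      using k(2) by (intro measure_pmf.finite_measure_mono) auto
    also have "\<dots> \<le> exp 1 * real m * exp (- (real m ^ r / fact k ^ (r - 1)) / (exp 1 * fact r))"
      using r k m1 m_le by (intro prob_bt_less) (auto simp: m_def)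
    also have "\<dots> \<le> exp 1 * real n * exp (- (exp (\<delta> * L) / K))"
    proof (intro mult_mono)
      show "exp (- (real m ^ r / fact k ^ (r - 1)) / (exp 1 * fact r)) \<le> exp (- (exp (\<delta> * L) / K))"
        using divide_right_mono[OF ratio, of K] pos by (simp add: K_def)
    qed (auto simp: m_def)
    finally show ?case by (simp add: b_def u_def L_def)
  qed
qed auto

theorem theorem5p1:
  fixes r :: nat
  assumes "r \<ge> 2"
  shows "aas_asymp (\<lambda>\<pi>. real (bt r \<pi>)) (real r / (real r - 1))
           (\<lambda>n. ln (real n) / ln (ln (real n)))"
  unfolding aas_asymp_def aas_def rate_def[symmetric]
proof (intro allI impI)
  fix \<epsilon> :: real assume \<epsilon>: "\<epsilon> > 0"
  define c where "c = real r / (real r - 1)"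
  \<comment> \<open>The lower tail bound needs a constant above 1, so a large \<open>\<epsilon>\<close> is replaced by a smaller one.\<close>
  define y where "y = max (c - \<epsilon>) ((c + 1) / 2)"
  have "c > 1" using assms by (simp add: c_def field_simps)
  with \<epsilon> have y: "1 < y" "y < c" by (auto simp: y_def less_max_iff_disj)
  let ?P = "\<lambda>n. measure_pmf.prob (random_permutation n)"
  let ?G = "\<lambda>n. {\<pi>. (real r / (real r - 1) - \<epsilon>) * rate (real n) \<le> real (bt r \<pi>) \<and>
      real (bt r \<pi>) \<le> (real r / (real r - 1) + \<epsilon>) * rate (real n)}"
  let ?U = "\<lambda>n. {\<pi>. (c + \<epsilon>) * rate (real n) < real (bt r \<pi>)}"
  let ?L = "\<lambda>n. {\<pi>. real (bt r \<pi>) < y * rate (real n)}"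
  have U: "(\<lambda>n. ?P n (?U n)) \<longlonglongrightarrow> 0"
    using assms \<epsilon> by (intro upper_tail) (auto simp: c_def)
  have L: "(\<lambda>n. ?P n (?L n)) \<longlonglongrightarrow> 0"
    using assms y by (intro lower_tail) (auto simp: c_def)
  have "eventually (\<lambda>x. 1 \<le> 1 * rate x) at_top"
    using rate_at_top[of 1] by (simp add: filterlim_at_top)
  then have pos: "eventually (\<lambda>n. 1 \<le> 1 * rate (real n)) sequentially"
    by (rule real_to_nat_eventually)
  show "(\<lambda>n. ?P n (?G n)) \<longlonglongrightarrow> 1"
  proof (rule tendsto_sandwich)
    show "(\<lambda>n. 1 - (?P n (?U n) + ?P n (?L n))) \<longlonglongrightarrow> 1"
      using tendsto_diff[OF tendsto_const[of 1] tendsto_add[OF U L]] by simp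
    show "eventually (\<lambda>n. 1 - (?P n (?U n) + ?P n (?L n)) \<le> ?P n (?G n)) sequentially"
      using pos
    proof eventually_elim
      case (elim n)
      have "(c - \<epsilon>) * rate (real n) \<le> y * rate (real n)"
        using elim by (intro mult_right_mono) (auto simp: y_def)
      then have "UNIV \<subseteq> ?G n \<union> (?U n \<union> ?L n)"
        by (auto simp: c_def)
      then have "?P n UNIV \<le> ?P n (?G n \<union> (?U n \<union> ?L n))"
        by (intro measure_pmf.finite_measure_mono) auto
      also have "\<dots> \<le> ?P n (?G n) + ?P n (?U n \<union> ?L n)"
        by (intro measure_Un_le) auto
      also have "?P n (?U n \<union> ?L n) \<le> ?P n (?U n) + ?P n (?L n)"
        by (intro measure_Un_le) auto
      finally show ?case by simp
    qed
    show "eventually (\<lambda>n. ?P n (?G n) \<le> 1) sequentially" by simp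
  qed simp
qed

end
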